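(* Let $n\ge1$, $k>0$, $1\le j\le n+1$, let $f:\mathbb{R}\to\mathbb{R}$ be smooth and define $F(\lambda_1,\dots,\lambda_{n+1})=f(\lambda_j)$. Then for every $\lambda\in\mathbb{R}^{n+1}$, $$V_k(F)(\lambda)=c_{n,k}\int_\sigma f(\lambda_1t_1+\dots+\lambda_{n+1}t_{n+1})\,t_j\,(t_1\cdots t_{n+1})^{k-1}\,dt.$$
   Context: Root system $A_n$ on $\mathbb{R}^{n+1}$ (no normalization $\sum x_i=0$), constant multiplicity $k>0$, Dunkl operators $T_jf(\lambda)=\partial_{\lambda_j}f(\lambda)+k\sum_{i\neq j}\frac{f(\lambda)-f((i,j)\lambda)}{\lambda_j-\lambda_i}$. The intertwining operator $V_k$ is the unique linear operator on polynomials with $T_jV_k=V_k\partial_j$, preserving homogeneous polynomials of each degree, with $V_k1=1$; it is given by $V_kf(\lambda)=\int f\,d\mu_\lambda$ for a compactly supported positive probability measure $\mu_\lambda$, which defines $V_k$ on smooth functions. $c_{n,k}=\frac{(n+1)\Gamma((n+1)k)}{\Gamma(k)^{n+1}}$, $\sigma=\{(t_1,\dots,t_{n+1}):t_p\ge0,\ \sum_pt_p=1\}$, $dt=dt_1\cdots dt_n$ with $t_{n+1}=1-t_1-\dots-t_n$. *)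

theory Defs
  imports "HOL-Probability.Probability"
begin

text \<open>Points of R^(n+1) are functions nat => real; only coordinates 1..n+1 matter.\<close>

definition monomial :: "nat \<Rightarrow> (nat \<Rightarrow> nat) \<Rightarrow> (nat \<Rightarrow> real) \<Rightarrow> real" where
  "monomial n a x = (\<Prod>i\<in>{1..n+1}. x i ^ a i)"

definition poly_fun :: "nat \<Rightarrow> ((nat \<Rightarrow> real) \<Rightarrow> real) \<Rightarrow> bool" where
  "poly_fun n p \<longleftrightarrow> (\<exists>S c. finite S \<and> p = (\<lambda>x. \<Sum>a\<in>S. c a * monomial n a x))"

definition hom_poly_fun :: "nat \<Rightarrow> nat \<Rightarrow> ((nat \<Rightarrow> real) \<Rightarrow> real) \<Rightarrow> bool" where
  "hom_poly_fun n d p \<longleftrightarrow> (\<exists>S c. finite S \<and> (\<forall>a\<in>S. (\<Sum>i\<in>{1..n+1}. a i) = d) \<and>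
      p = (\<lambda>x. \<Sum>a\<in>S. c a * monomial n a x))"

definition swp :: "nat \<Rightarrow> nat \<Rightarrow> (nat \<Rightarrow> real) \<Rightarrow> (nat \<Rightarrow> real)" where
  "swp i j x = (\<lambda>p. if p = i then x j else if p = j then x i else x p)"

definition pd :: "nat \<Rightarrow> ((nat \<Rightarrow> real) \<Rightarrow> real) \<Rightarrow> (nat \<Rightarrow> real) \<Rightarrow> real" where
  "pd j f x = deriv (\<lambda>s. f (x(j := x j + s))) 0"

definition dunkl :: "nat \<Rightarrow> real \<Rightarrow> nat \<Rightarrow> ((nat \<Rightarrow> real) \<Rightarrow> real) \<Rightarrow> (nat \<Rightarrow> real) \<Rightarrow> real" where
  "dunkl n k j f x = pd j f x + k * (\<Sum>i\<in>{1..n+1} - {j}. (f x - f (swp i j x)) / (x j - x i))"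

definition is_intertwiner :: "nat \<Rightarrow> real \<Rightarrow> (((nat \<Rightarrow> real) \<Rightarrow> real) \<Rightarrow> ((nat \<Rightarrow> real) \<Rightarrow> real)) \<Rightarrow> bool" where
  "is_intertwiner n k V \<longleftrightarrow>
     (\<forall>p q. poly_fun n p \<longrightarrow> poly_fun n q \<longrightarrow> V (\<lambda>x. p x + q x) = (\<lambda>x. V p x + V q x)) \<and>
     (\<forall>p c. poly_fun n p \<longrightarrow> V (\<lambda>x. c * p x) = (\<lambda>x. c * V p x)) \<and>
     (\<forall>d p. hom_poly_fun n d p \<longrightarrow> hom_poly_fun n d (V p)) \<and>
     V (\<lambda>x. 1) = (\<lambda>x. 1) \<and>
     (\<forall>j p x. j \<in> {1..n+1} \<longrightarrow> poly_fun n p \<longrightarrow> inj_on x {1..n+1} \<longrightarrow>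
        dunkl n k j (V p) x = V (pd j p) x)"

definition represents :: "nat \<Rightarrow> (((nat \<Rightarrow> real) \<Rightarrow> real) \<Rightarrow> ((nat \<Rightarrow> real) \<Rightarrow> real))
    \<Rightarrow> ((nat \<Rightarrow> real) \<Rightarrow> (nat \<Rightarrow> real) measure) \<Rightarrow> bool" where
  "represents n V \<mu> \<longleftrightarrow> (\<forall>x.
     sets (\<mu> x) = sets (PiM {1..n+1} (\<lambda>_. lborel)) \<and>
     prob_space (\<mu> x) \<and>
     (\<exists>B. AE y in \<mu> x. \<forall>i\<in>{1..n+1}. \<bar>y i\<bar> \<le> B) \<and>
     (\<forall>p. poly_fun n p \<longrightarrow> V p x = integral\<^sup>L (\<mu> x) p))"

definition smooth_fun :: "(real \<Rightarrow> real) \<Rightarrow> bool" where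
  "smooth_fun f \<longleftrightarrow> (\<forall>m x. (deriv ^^ m) f differentiable (at x))"

definition c_const :: "nat \<Rightarrow> real \<Rightarrow> real" where
  "c_const n k = (real n + 1) * Gamma ((real n + 1) * k) / Gamma k ^ (n + 1)"

text \<open>Simplex sigma parametrised by (t_1..t_n); t_(n+1) = 1 - t_1 - ... - t_n.\<close>
definition tfull :: "nat \<Rightarrow> (nat \<Rightarrow> real) \<Rightarrow> nat \<Rightarrow> real" where
  "tfull n t p = (if p = n + 1 then 1 - (\<Sum>q\<in>{1..n}. t q) else t p)"

definition simplex_par :: "nat \<Rightarrow> (nat \<Rightarrow> real) set" where
  "simplex_par n = {t. \<forall>p\<in>{1..n+1}. tfull n t p \<ge> 0}"

end

theory Submission
  imports Defs
begin

text \<open>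
  Write \<open>N = n + 1\<close>, \<open>w(t) = (t\<^sub>1 \<cdots> t\<^sub>N)\<^bsup>k-1\<^esup>\<close>, and let \<open>F\<^sub>d(x)\<close> be the right-hand side for
  \<open>f(s) = s\<^bsup>d\<^esup>\<close>. Summing \<open>x\<^sub>i T\<^sub>i\<close> and using Euler's identity, every homogeneous
  \<open>q\<close> of degree \<open>d\<close> satisfies \<open>\<Sum>\<^sub>i x\<^sub>i T\<^sub>i q = d q + k \<Sum>\<^bsub>i<m\<^esub> (q - (i,m) q)\<close>. Hence
  \<open>q = V(x\<^sub>j\<^bsup>d\<^esup>)\<close> solves
  \<open>d q + k \<Sum>\<^bsub>i<m\<^esub> (q - (i,m) q) = d x\<^sub>j V(x\<^sub>j\<^bsup>d-1\<^esup>)\<close>. For given right-hand side the solution is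
  unique by a maximum principle on the orbit of \<open>x\<close> under the symmetric group, and \<open>F\<^sub>d\<close> solves the
  same equation because of the integration by parts identity
  \<open>(d + kN) \<integral> (x\<cdot>t)\<^bsup>d\<^esup> t\<^sub>j w = k \<integral> (x\<cdot>t)\<^bsup>d\<^esup> w + d x\<^sub>j \<integral> (x\<cdot>t)\<^bsup>d-1\<^esup> t\<^sub>j w\<close>.
  So both sides of the theorem have the same moments, and the Weierstrass approximation theorem
  extends the equality from polynomials to continuous \<open>f\<close>.
\<close>

section \<open>Dirichlet integrals\<close>

text \<open>Substituting \<open>s * t\<close> for \<open>t\<close> reduces this to the Beta integral
  over the unit interval. At \<open>s = 0\<close> the substitution degenerates, but both sides
  vanish because \<open>0 powr y = 0\<close>.\<close>

lemma nn_integral_Beta_scaled: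
  fixes a b s :: real
  assumes "a > 0" "b > 0" "s \<ge> 0"
  shows "(\<integral>\<^sup>+t. ennreal (indicator {0..s} t * (t powr (a - 1) * (s - t) powr (b - 1))) \<partial>lborel)
    = ennreal (Beta a b * s powr (a + b - 1))"
proof (cases "s = 0")
  case True
  have "(\<integral>\<^sup>+t. ennreal (indicator {0..s} t * (t powr (a - 1) * (s - t) powr (b - 1))) \<partial>lborel)
    = (\<integral>\<^sup>+(t::real). 0 \<partial>lborel)"
    using True by (intro nn_integral_cong) (auto simp: indicator_def)
  then show ?thesis using True by simp
next
  case False
  then have s: "s > 0" using assms by simp
  have eq: "indicator {0..s} (s * t) * ((s * t) powr (a - 1) * (s - s * t) powr (b - 1))
     = s powr (a + b - 2) * (indicator {0..1} t * (t powr (a - 1) * (1 - t) powr (b - 1)))" for t :: real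
  proof (cases "t \<in> {0..1}")
    case True
    then have "(s * t) powr (a - 1) = s powr (a - 1) * t powr (a - 1)"
      using s by (simp add: powr_mult)
    moreover have "(s - s * t) powr (b - 1) = s powr (b - 1) * (1 - t) powr (b - 1)"
      using s True powr_mult[of s "1 - t" "b - 1"] by (simp add: right_diff_distrib)
    moreover have "s powr (a - 1) * s powr (b - 1) = s powr (a + b - 2)"
      by (simp add: powr_add[symmetric])
    moreover have "s * t \<in> {0..s}" using True s by (auto simp: mult_left_le)
    ultimately show ?thesis using True by (simp add: algebra_simps)
  next
    case False
    then have "s * t \<notin> {0..s}" using s by (auto simp: zero_le_mult_iff mult_le_cancel_left1)
    then show ?thesis using False by simp
  qed
  have B: "(\<integral>\<^sup>+t. ennreal (indicator {0..1} t * (t powr (a - 1) * (1 - t) powr (b - 1))) \<partial>lborel)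
    = ennreal (Beta a b)"
    using nn_integral_has_integral_lebesgue'[OF _ has_integral_Beta_real[OF assms(1,2)]]
    by (simp add: indicator_mult_ennreal mult.commute)
  have "(\<integral>\<^sup>+t. ennreal (indicator {0..s} t * (t powr (a - 1) * (s - t) powr (b - 1))) \<partial>lborel)
    = ennreal s * (\<integral>\<^sup>+t. ennreal (s powr (a + b - 2)) *
        ennreal (indicator {0..1} t * (t powr (a - 1) * (1 - t) powr (b - 1))) \<partial>lborel)"
    using s by (subst nn_integral_real_affine[where c = s and t = 0])
      (simp_all add: eq ennreal_mult')
  also have "\<dots> = ennreal (s * (s powr (a + b - 2) * Beta a b))"
    unfolding B[symmetric] ennreal_mult'[OF assms(3)] ennreal_mult'[OF powr_ge_zero]
    by (subst nn_integral_cmult) simp_all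
  also have "s * (s powr (a + b - 2) * Beta a b) = Beta a b * s powr (a + b - 1)"
    using s powr_add[of s 1 "a + b - 2"] by (simp add: algebra_simps)
  finally show ?thesis .
qed

text \<open>Integrating out one coordinate \<open>u\<close> over \<open>{0..1 - sum t I}\<close>
  gives \<open>Beta (a i) b\<close> times the same integrand on \<open>I\<close> with
  \<open>b\<close> replaced by \<open>a i + b\<close>. The induction must therefore leave
  \<open>b\<close> arbitrary; the new factor \<open>Gamma (a i + b)\<close> cancels against the Beta
  denominator.\<close>

lemma nn_integral_Dirichlet:
  fixes a :: "'i \<Rightarrow> real" and b :: real
  assumes "finite I" "\<And>p. p \<in> I \<Longrightarrow> a p > 0" "b > 0"
  shows "(\<integral>\<^sup>+t. ennreal (indicator {t. (\<forall>p\<in>I. 0 \<le> t p) \<and> sum t I \<le> 1} t *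
       ((\<Prod>p\<in>I. t p powr (a p - 1)) * (1 - sum t I) powr (b - 1))) \<partial>PiM I (\<lambda>_. lborel))
    = ennreal ((\<Prod>p\<in>I. Gamma (a p)) * Gamma b / Gamma (sum a I + b))"
  using assms
proof (induction I arbitrary: b rule: finite_induct)
  case empty
  interpret product_sigma_finite "\<lambda>_::'i. lborel :: real measure" ..
  have "Gamma b > 0" using empty by simp
  then have "Gamma b \<noteq> 0" by linarith
  then show ?case by (simp add: PiM_empty)
next
  case (insert i I)
  interpret product_sigma_finite "\<lambda>_::'i. lborel :: real measure" ..
  let ?g = "\<lambda>J b t. indicator {t. (\<forall>p\<in>J. 0 \<le> t p) \<and> sum t J \<le> 1} t *
       ((\<Prod>p\<in>J. t p powr (a p - 1)) * (1 - sum t J) powr (b - 1))"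
  have a: "a i > 0" "b > 0" using insert by auto
  have [measurable]: "(\<lambda>t. ennreal (?g J b t)) \<in> borel_measurable (PiM J (\<lambda>_. lborel))"
    if "finite J" for J b
  proof -
    have [measurable]: "Measurable.pred (PiM J (\<lambda>_. lborel :: real measure)) (\<lambda>t. \<forall>p\<in>J. 0 \<le> t p)"
      using that by measurable
    show ?thesis using that by measurable
  qed
  have "(\<integral>\<^sup>+t. ennreal (?g (insert i I) b t) \<partial>PiM (insert i I) (\<lambda>_. lborel))
     = (\<integral>\<^sup>+t. (\<integral>\<^sup>+u. ennreal (?g (insert i I) b (t(i := u))) \<partial>lborel) \<partial>PiM I (\<lambda>_. lborel))"
    using insert by (subst product_nn_integral_insert) simp_all
  also have "\<dots> = (\<integral>\<^sup>+t. ennreal (Beta (a i) b) * ennreal (?g I (a i + b) t) \<partial>PiM I (\<lambda>_. lborel))"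
  proof (rule nn_integral_cong)
    fix t :: "'i \<Rightarrow> real"
    let ?s = "1 - sum t I" and ?c = "\<Prod>p\<in>I. t p powr (a p - 1)"
    have up: "sum (t(i := u)) I = sum t I" "(\<Prod>p\<in>I. (t(i := u)) p powr (a p - 1)) = ?c"
      "(\<forall>p\<in>I. 0 \<le> (t(i := u)) p) = (\<forall>p\<in>I. 0 \<le> t p)" for u
      using insert.hyps by (auto intro!: sum.cong prod.cong)
    \<comment> \<open>The slice of the larger simplex above \<open>t\<close> is the interval
      \<open>{0..?s}\<close> if \<open>t\<close> lies in the smaller simplex, and is empty
      otherwise.\<close>
    have ins: "?g (insert i I) b (t(i := u)) =
      indicator {t. (\<forall>p\<in>I. 0 \<le> t p) \<and> sum t I \<le> 1} t * ?c *
        (indicator {0..?s} u * (u powr (a i - 1) * (?s - u) powr (b - 1)))" for u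
      using insert.hyps by (auto simp: up indicator_def algebra_simps simp del: fun_upd_apply)
         (auto simp: fun_upd_def add_ac)
    have c: "?c \<ge> 0" by (intro prod_nonneg) auto
    show "(\<integral>\<^sup>+u. ennreal (?g (insert i I) b (t(i := u))) \<partial>lborel)
      = ennreal (Beta (a i) b) * ennreal (?g I (a i + b) t)"
    proof (cases "(\<forall>p\<in>I. 0 \<le> t p) \<and> sum t I \<le> 1")
      case True
      then have "(\<integral>\<^sup>+u. ennreal (?g (insert i I) b (t(i := u))) \<partial>lborel)
        = (\<integral>\<^sup>+u. ennreal ?c * ennreal (indicator {0..?s} u * (u powr (a i - 1) * (?s - u) powr (b - 1))) \<partial>lborel)"
        unfolding ins using c by (intro nn_integral_cong) (simp add: ennreal_mult')
      also have "\<dots> = ennreal ?c * ennreal (Beta (a i) b * ?s powr (a i + b - 1))"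
        using True a by (subst nn_integral_cmult) (simp_all add: nn_integral_Beta_scaled)
      also have "\<dots> = ennreal (Beta (a i) b) * ennreal (?g I (a i + b) t)"
        using True c a
        by (simp add: ennreal_mult'[symmetric] ennreal_mult''[symmetric] prod_nonneg Beta_def mult_ac)
      finally show ?thesis .
    next
      case False
      then show ?thesis unfolding ins by auto
    qed
  qed
  also have "\<dots> = ennreal (Beta (a i) b) *
      ennreal ((\<Prod>p\<in>I. Gamma (a p)) * Gamma (a i + b) / Gamma (sum a I + (a i + b)))"
    using insert.hyps insert.IH[OF insert.prems(1) add_pos_pos[OF a]]
    by (subst nn_integral_cmult) simp_all
  also have "\<dots> = ennreal (Beta (a i) b *
      ((\<Prod>p\<in>I. Gamma (a p)) * Gamma (a i + b) / Gamma (sum a I + (a i + b))))"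
    using a by (intro ennreal_mult'[symmetric]) (simp add: Beta_def)
  also have "Beta (a i) b * ((\<Prod>p\<in>I. Gamma (a p)) * Gamma (a i + b) / Gamma (sum a I + (a i + b)))
     = (\<Prod>p\<in>insert i I. Gamma (a p)) * Gamma b / Gamma (sum a (insert i I) + b)"
  proof -
    have "Gamma (a i + b) > 0" using a by simp
    then show ?thesis using insert.hyps by (simp add: Beta_def field_simps)
  qed
  finally show ?case .
qed

section \<open>Moments of the Dirichlet density\<close>

text \<open>The exponent vector after multiplying a monomial by its \<open>j\<close>-th
  variable.\<close>

definition incr :: "'i \<Rightarrow> ('i \<Rightarrow> nat) \<Rightarrow> 'i \<Rightarrow> nat" where
  "incr j a = a(j := Suc (a j))"

lemma incr_apply: "incr j a p = (if p = j then Suc (a j) else a p)"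
  by (simp add: incr_def)

lemma incr_commute: "incr i (incr j a) = incr j (incr i a)"
  by (auto simp: incr_def)

text \<open>The closed form of the integral of \<open>w\<close> times the monomial with exponents
  \<open>a\<close>, a Dirichlet integral with parameters \<open>k + a p\<close>. For
  \<open>A = {1..n+1}\<close> this is \<open>has_integral_Dirichlet_monomial\<close>.\<close>

definition dirichlet_value :: "'i set \<Rightarrow> real \<Rightarrow> ('i \<Rightarrow> nat) \<Rightarrow> real" where
  "dirichlet_value A k a =
    (\<Prod>p\<in>A. Gamma (k + real (a p))) / Gamma (\<Sum>p\<in>A. k + real (a p))"

text \<open>The recursive form of \<open>\<integral> (x\<cdot>t)\<^bsup>d\<^esup> t\<^bsup>a\<^esup> w\<close>, obtained by expanding one factor \<open>x\<cdot>t\<close>. Unlike the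
  integral over \<open>t\<^sub>1, \<dots>, t\<^sub>n\<close>, it is visibly symmetric in all coordinates.\<close>

fun dirichlet_moment :: "'i set \<Rightarrow> real \<Rightarrow> nat \<Rightarrow> ('i \<Rightarrow> nat) \<Rightarrow> ('i \<Rightarrow> real) \<Rightarrow> real" where
  "dirichlet_moment A k 0 a x = dirichlet_value A k a"
| "dirichlet_moment A k (Suc d) a x = (\<Sum>p\<in>A. x p * dirichlet_moment A k d (incr p a) x)"

lemma sum_incr:
  assumes "finite A" "j \<in> A"
  shows "(\<Sum>p\<in>A. k + real (incr j a p)) = (\<Sum>p\<in>A. k + real (a p)) + 1"
  using assms by (simp add: sum.remove[of _ j] incr_apply)

text \<open>\<open>Gamma (z + 1) = z * Gamma z\<close>, used once in the numerator at
  \<open>z = k + a j\<close> and once in the denominator at the total parameter.\<close>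

lemma dirichlet_value_incr:
  assumes "finite A" "k > 0" "j \<in> A"
  shows "(\<Sum>p\<in>A. k + real (a p)) * dirichlet_value A k (incr j a)
    = (k + real (a j)) * dirichlet_value A k a"
proof -
  let ?s = "\<Sum>p\<in>A. k + real (a p)"
  have s: "?s > 0" using assms by (intro sum_pos) (auto intro: add_pos_nonneg)
  have "Gamma (?s + 1) = ?s * Gamma ?s" using s by (intro Gamma_plus1) (auto elim!: nonpos_Ints_cases)
  moreover have "(\<Prod>p\<in>A. Gamma (k + real (incr j a p)))
      = (k + real (a j)) * (\<Prod>p\<in>A. Gamma (k + real (a p)))"
  proof -
    have "k + real (a j) > 0" using assms by (simp add: add_pos_nonneg)
    then have "Gamma (k + real (a j) + 1) = (k + real (a j)) * Gamma (k + real (a j))"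
      by (intro Gamma_plus1) (auto elim!: nonpos_Ints_cases)
    then show ?thesis using assms by (simp add: prod.remove[of _ j] incr_apply add_ac)
  qed
  ultimately show ?thesis using s by (simp add: dirichlet_value_def sum_incr[OF assms(1,3)])
qed

text \<open>An integration by parts for the Dirichlet density, obtained here from the functional
  equation of \<open>Gamma\<close>.\<close>

lemma dirichlet_moment_recurrence:
  assumes "finite A" "k > 0" "j \<in> A"
  shows "(real d + (\<Sum>p\<in>A. k + real (a p))) * dirichlet_moment A k d (incr j a) x
    = (k + real (a j)) * dirichlet_moment A k d a x
      + real d * x j * dirichlet_moment A k (d - 1) (incr j a) x"
proof (induction d arbitrary: a)
  case 0
  then show ?case using dirichlet_value_incr[OF assms] by simp
next
  case (Suc d)
  let ?M = "\<lambda>d a. dirichlet_moment A k d a x"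
  let ?S = "\<Sum>p\<in>A. k + real (a p)"
  \<comment> \<open>The induction hypothesis is taken at \<open>incr p a\<close>: this raises the
    parameter sum by 1, which turns \<open>d\<close> into \<open>Suc d\<close> on the left, and
    raises the coefficient \<open>k + a j\<close> exactly when \<open>p = j\<close>.\<close>
  have IH: "(real (Suc d) + ?S) * ?M d (incr j (incr p a))
     = (k + real (a j) + (if p = j then 1 else 0)) * ?M d (incr p a)
       + real d * x j * ?M (d - 1) (incr p (incr j a))" if "p \<in> A" for p
  proof -
    have "k + real (incr p a j) = k + real (a j) + (if p = j then 1 else 0)"
      by (simp add: incr_apply)
    then show ?thesis
      using Suc.IH[of "incr p a"] unfolding sum_incr[OF assms(1) that] incr_commute[of p j]
      by (simp add: add_ac)
  qed
  have "(real (Suc d) + ?S) * ?M (Suc d) (incr j a)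
      = (\<Sum>p\<in>A. x p * ((real (Suc d) + ?S) * ?M d (incr j (incr p a))))"
    unfolding dirichlet_moment.simps sum_distrib_left
    by (intro sum.cong refl) (simp only: incr_commute[of j] mult_ac)
  also have "\<dots> = (\<Sum>p\<in>A. (k + real (a j)) * (x p * ?M d (incr p a))
      + (if p = j then x j * ?M d (incr j a) else 0)
      + real d * x j * (x p * ?M (d - 1) (incr p (incr j a))))"
    by (intro sum.cong refl) (simp only: IH, simp add: algebra_simps)
  also have "\<dots> = (k + real (a j)) * ?M (Suc d) a + x j * ?M d (incr j a)
      + real d * x j * (\<Sum>p\<in>A. x p * ?M (d - 1) (incr p (incr j a)))"
    using assms by (simp add: sum.distrib sum_distrib_left[symmetric])
  \<comment> \<open>At \<open>d = 0\<close> the truncated \<open>d - 1\<close> does no harm, since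
    the factor \<open>real d\<close> is zero.\<close>
  also have "real d * x j * (\<Sum>p\<in>A. x p * ?M (d - 1) (incr p (incr j a)))
      = real d * x j * ?M d (incr j a)"
    by (cases d) simp_all
  finally show ?case by (simp add: algebra_simps)
qed

lemma swp_eq_comp: "swp i m x = x \<circ> Transposition.transpose i m"
  by (auto simp: swp_def Transposition.transpose_def)

text \<open>The base value is a symmetric expression in the exponents, and in each recursion step
  the sum over \<open>p\<close> can be reindexed by the transposition.\<close>

lemma dirichlet_moment_swp:
  assumes "i \<in> A" "m \<in> A"
  shows "dirichlet_moment A k d a (swp i m x)
    = dirichlet_moment A k d (a \<circ> Transposition.transpose i m) x"
proof -
  let ?s = "Transposition.transpose i m"
  have bij: "bij_betw ?s A A"
    using assms by (intro bij_betw_byWitness[where f' = ?s]) (auto simp: Transposition.transpose_def)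
  show ?thesis
  proof (induction d arbitrary: a)
    case 0
    show ?case
      using prod.reindex_bij_betw[OF bij, of "\<lambda>p. Gamma (k + real (a p))"]
        sum.reindex_bij_betw[OF bij, of "\<lambda>p. k + real (a p)"]
      by (simp add: dirichlet_value_def)
  next
    case (Suc d)
    have upd: "incr (?s p) a \<circ> ?s = incr p (a \<circ> ?s)" for p
      by (auto simp: fun_eq_iff Transposition.transpose_def incr_apply)
    have "dirichlet_moment A k (Suc d) a (swp i m x)
      = (\<Sum>p\<in>A. x (?s p) * dirichlet_moment A k d (incr p a \<circ> ?s) x)"
      by (simp add: Suc.IH) (simp add: swp_eq_comp comp_def)
    also have "\<dots> = (\<Sum>p\<in>A. x (?s (?s p)) * dirichlet_moment A k d (incr (?s p) a \<circ> ?s) x)"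
      by (rule sum.reindex_bij_betw[OF bij, symmetric])
    also have "\<dots> = dirichlet_moment A k (Suc d) (a \<circ> ?s) x"
      by (simp add: upd)
    finally show ?case .
  qed
qed

text \<open>The recursive form of the integral with the extra factor \<open>t_j\<close>. On
  \<open>{1..n+1}\<close> it is \<open>F_d\<close> up to the constant
  \<open>c_const n k\<close>.\<close>

abbreviation dirichlet_coord_moment :: "'i set \<Rightarrow> real \<Rightarrow> nat \<Rightarrow> 'i \<Rightarrow> ('i \<Rightarrow> real) \<Rightarrow> real" where
  "dirichlet_coord_moment A k d j \<equiv> dirichlet_moment A k d (incr j (\<lambda>_. 0))"

lemma dirichlet_coord_moment_recurrence:
  assumes "finite A" "k > 0" "j \<in> A"
  shows "(real d + real (card A) * k) * dirichlet_coord_moment A k d j x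
    = k * dirichlet_moment A k d (\<lambda>_. 0) x
      + real d * (x j * dirichlet_coord_moment A k (d - 1) j x)"
  using dirichlet_moment_recurrence[OF assms, of d "\<lambda>_. 0" x] by (simp add: mult_ac)

text \<open>The counterpart of \<open>t_1 + ... + t_N = 1\<close> on the simplex. It follows by
  summing the recurrence over all coordinates and cancelling the positive factor
  \<open>d + N k\<close>.\<close>

lemma sum_dirichlet_coord_moment:
  assumes "finite A" "A \<noteq> {}" "k > 0"
  shows "(\<Sum>m\<in>A. dirichlet_coord_moment A k d m x) = dirichlet_moment A k d (\<lambda>_. 0) x"
proof -
  let ?M = "\<lambda>d. dirichlet_moment A k d (\<lambda>_. 0) x"
  let ?N = "real (card A) * k"
  have N: "?N > 0" using assms by (simp add: card_gt_0_iff)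
  have "(real d + ?N) * (\<Sum>m\<in>A. dirichlet_coord_moment A k d m x)
     = (\<Sum>m\<in>A. k * ?M d + real d * (x m * dirichlet_coord_moment A k (d - 1) m x))"
    unfolding sum_distrib_left
    by (intro sum.cong refl dirichlet_coord_moment_recurrence assms)
  also have "\<dots> = ?N * ?M d + real d * (\<Sum>m\<in>A. x m * dirichlet_coord_moment A k (d - 1) m x)"
    by (simp add: sum.distrib sum_distrib_left algebra_simps)
  also have "real d * (\<Sum>m\<in>A. x m * dirichlet_coord_moment A k (d - 1) m x) = real d * ?M d"
    by (cases d) simp_all
  finally have "(real d + ?N) * (\<Sum>m\<in>A. dirichlet_coord_moment A k d m x)
      = (real d + ?N) * ?M d" by (simp add: algebra_simps)
  moreover have "real d + ?N \<noteq> 0" using N by linarith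
  ultimately show ?thesis by simp
qed

lemma dirichlet_coord_moment_swp:
  assumes "m \<in> A" "i \<in> A"
  shows "dirichlet_coord_moment A k d j (swp m i x)
    = dirichlet_coord_moment A k d (Transposition.transpose m i j) x"
proof -
  have "incr j (\<lambda>_. 0) \<circ> Transposition.transpose m i
      = incr (Transposition.transpose m i j) (\<lambda>_. 0)"
    by (auto simp: fun_eq_iff Transposition.transpose_def incr_apply)
  then show ?thesis using dirichlet_moment_swp[OF assms] by simp
qed

text \<open>Swapping \<open>j\<close> with \<open>m\<close> turns \<open>F d j\<close> into
  \<open>F d m\<close>, and swaps that fix \<open>j\<close> contribute nothing. The double sum is
  thus twice the sum of \<open>F d j - F d m\<close>, which is evaluated by
  \<open>sum_dirichlet_coord_moment\<close>; the recurrence does the rest. The factor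
  \<open>k / 2\<close> appears because ordered pairs are summed.\<close>

lemma dirichlet_coord_moment_Euler:
  fixes A :: "nat set"
  assumes "finite A" "k > 0" "j \<in> A"
  defines "F \<equiv> dirichlet_coord_moment A k"
  shows "real d * F d j x + k / 2 * (\<Sum>i\<in>A. \<Sum>m\<in>A - {i}. F d j x - F d j (swp m i x))
    = real d * (x j * F (d - 1) j x)"
proof -
  have "(\<Sum>i\<in>A. \<Sum>m\<in>A - {i}. F d j x - F d j (swp m i x))
      = (\<Sum>i\<in>A. \<Sum>m\<in>A. F d j x - F d j (swp m i x))"
    using assms(1) by (intro sum.cong refl sum.mono_neutral_left) (auto simp: swp_eq_comp)
  \<comment> \<open>For \<open>i = m = j\<close> both conditionals apply, but each of their
    differences is zero.\<close>
  also have "\<dots> = (\<Sum>i\<in>A. \<Sum>m\<in>A. (if i = j then F d j x - F d m x else 0)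
      + (if m = j then F d j x - F d i x else 0))"
    unfolding F_def
    by (intro sum.cong refl, subst dirichlet_coord_moment_swp)
       (auto simp: Transposition.transpose_def)
  also have "\<dots> = (\<Sum>i\<in>A. (if i = j then (\<Sum>m\<in>A. F d j x - F d m x) else 0)
      + (F d j x - F d i x))"
  proof (intro sum.cong refl)
    fix i assume "i \<in> A"
    show "(\<Sum>m\<in>A. (if i = j then F d j x - F d m x else 0) + (if m = j then F d j x - F d i x else 0))
      = (if i = j then (\<Sum>m\<in>A. F d j x - F d m x) else 0) + (F d j x - F d i x)"
      using assms(1,3) by (cases "i = j") (simp_all add: sum.distrib)
  qed
  also have "\<dots> = 2 * (\<Sum>m\<in>A. F d j x - F d m x)"
    using assms(1,3) by (simp add: sum.distrib)
  also have "(\<Sum>m\<in>A. F d j x - F d m x)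
      = real (card A) * F d j x - dirichlet_moment A k d (\<lambda>_. 0) x"
  proof -
    have "A \<noteq> {}" using assms(3) by auto
    then show ?thesis unfolding sum_subtractf F_def
      by (simp add: sum_dirichlet_coord_moment assms(1,2))
  qed
  finally have "k / 2 * (\<Sum>i\<in>A. \<Sum>m\<in>A - {i}. F d j x - F d j (swp m i x))
      = k * (real (card A) * F d j x - dirichlet_moment A k d (\<lambda>_. 0) x)"
    by simp
  then show ?thesis
    using dirichlet_coord_moment_recurrence[OF assms(1-3), of d x]
    unfolding F_def by (simp add: algebra_simps)
qed

section \<open>Powers of a coordinate under the intertwining operator\<close>

text \<open>The derivative is delivered as a witness with a differentiability fact, so that the
  derivatives of monomials can later be added term by term.\<close>

lemma Euler_monomial:
  assumes "i \<in> {1..n+1}"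
  obtains D where "((\<lambda>s. monomial n a (x(i := x i + s))) has_real_derivative D) (at 0)"
    and "x i * D = real (a i) * monomial n a x"
proof
  let ?R = "\<Prod>p\<in>{1..n+1} - {i}. x p ^ a p"
  have eq: "monomial n a (x(i := y)) = y ^ a i * ?R" for y
    unfolding monomial_def using assms by (subst prod.remove[of _ i]) (auto intro!: prod.cong)
  show "((\<lambda>s. monomial n a (x(i := x i + s))) has_real_derivative
      (real (a i) * x i ^ (a i - 1) * ?R)) (at 0)"
    unfolding eq by (auto intro!: derivative_eq_intros)
  have "monomial n a x = x i ^ a i * ?R" using eq[of "x i"] by simp
  \<comment> \<open>The case \<open>a i = 0\<close> is separate because the exponent
    \<open>a i - 1\<close> is truncated; both sides are then zero.\<close>
  then show "x i * (real (a i) * x i ^ (a i - 1) * ?R) = real (a i) * monomial n a x"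
    by (cases "a i") (simp_all del: prod.cl_ivl_Suc)
qed

lemma Euler_hom_poly_fun:
  assumes "hom_poly_fun n d q"
  shows "(\<Sum>i\<in>{1..n+1}. x i * pd i q x) = real d * q x"
proof -
  let ?A = "{1..n+1}"
  obtain S c where S: "finite S" "\<And>a. a \<in> S \<Longrightarrow> sum a ?A = d"
    and q: "q = (\<lambda>x. \<Sum>a\<in>S. c a * monomial n a x)"
    using assms unfolding hom_poly_fun_def by blast
  have "x i * pd i q x = (\<Sum>a\<in>S. c a * (real (a i) * monomial n a x))" if "i \<in> ?A" for i
  proof -
    have "\<exists>D. ((\<lambda>s. monomial n a (x(i := x i + s))) has_real_derivative D) (at 0)
        \<and> x i * D = real (a i) * monomial n a x" for a
      using Euler_monomial[OF that] by blast
    then obtain D where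
      D: "\<And>a. ((\<lambda>s. monomial n a (x(i := x i + s))) has_real_derivative D a) (at 0)"
        "\<And>a. x i * D a = real (a i) * monomial n a x" by metis
    have "((\<lambda>s. q (x(i := x i + s))) has_real_derivative (\<Sum>a\<in>S. c a * D a)) (at 0)"
      unfolding q by (intro DERIV_sum DERIV_cmult D)
    then have "pd i q x = (\<Sum>a\<in>S. c a * D a)" unfolding pd_def by (rule DERIV_imp_deriv)
    then show ?thesis by (simp add: sum_distrib_left D(2)[symmetric] mult_ac)
  qed
  then have "(\<Sum>i\<in>?A. x i * pd i q x) = (\<Sum>i\<in>?A. \<Sum>a\<in>S. c a * (real (a i) * monomial n a x))"
    by (intro sum.cong refl)
  also have "\<dots> = (\<Sum>a\<in>S. \<Sum>i\<in>?A. c a * (real (a i) * monomial n a x))"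
    by (rule sum.swap)
  also have "\<dots> = (\<Sum>a\<in>S. real d * (c a * monomial n a x))"
  proof (intro sum.cong refl)
    fix a assume "a \<in> S"
    have "(\<Sum>i\<in>?A. c a * (real (a i) * monomial n a x)) = real (sum a ?A) * (c a * monomial n a x)"
      unfolding of_nat_sum sum_distrib_right by (simp add: mult_ac del: sum.cl_ivl_Suc)
    then show "(\<Sum>i\<in>?A. c a * (real (a i) * monomial n a x)) = real d * (c a * monomial n a x)"
      using S(2)[OF \<open>a \<in> S\<close>] by (simp only:)
  qed
  finally show ?thesis by (simp add: q sum_distrib_left)
qed

text \<open>Pairing \<open>(i, m)\<close> with \<open>(m, i)\<close> removes the denominators,
  because \<open>x_i / (x_i - x_m) + x_m / (x_m - x_i) = 1\<close> and the difference
  \<open>q x - q (swp m i x)\<close> is symmetric in \<open>i\<close> and \<open>m\<close>. Euler's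
  identity handles the partial derivatives.\<close>

lemma Euler_dunkl:
  assumes "hom_poly_fun n d q" "inj_on x {1..n+1}"
  shows "(\<Sum>i\<in>{1..n+1}. x i * dunkl n k i q x)
    = real d * q x + k / 2 * (\<Sum>i\<in>{1..n+1}. \<Sum>m\<in>{1..n+1} - {i}. q x - q (swp m i x))"
proof -
  let ?A = "{1..n+1}"
  let ?D = "\<lambda>i m. q x - q (swp m i x)"
  let ?g = "\<lambda>i m. x i * (?D i m / (x i - x m))"
  let ?S = "\<Sum>i\<in>?A. \<Sum>m\<in>?A. ?g i m"
  have D0: "?D i i = 0" and Dsym: "?D i m = ?D m i" for i m
    by (simp_all add: swp_eq_comp transpose_commute)
  have full: "(\<Sum>m\<in>?A - {i}. h i m) = (\<Sum>m\<in>?A. h i m)" if "\<And>i. h i i = 0" for h :: "nat \<Rightarrow> nat \<Rightarrow> real" and i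
    using that by (intro sum.mono_neutral_left) auto
  have "?S = (\<Sum>i\<in>?A. \<Sum>m\<in>?A. ?g m i)" by (rule sum.swap)
  then have "2 * ?S = (\<Sum>i\<in>?A. \<Sum>m\<in>?A. ?g i m + ?g m i)" by (simp add: sum.distrib)
  also have "\<dots> = (\<Sum>i\<in>?A. \<Sum>m\<in>?A. ?D i m)"
  proof (intro sum.cong refl)
    fix i m assume "i \<in> ?A" "m \<in> ?A"
    show "?g i m + ?g m i = ?D i m"
    proof (cases "i = m")
      case True
      then show ?thesis using D0 by simp
    next
      case False
      then have "x i - x m \<noteq> 0" "x m - x i \<noteq> 0"
        using assms(2) \<open>i \<in> ?A\<close> \<open>m \<in> ?A\<close> by (auto dest: inj_onD)
      then have "x i * (D / (x i - x m)) + x m * (D / (x m - x i)) = D" for D :: real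
        by (simp add: divide_simps) (simp add: algebra_simps)
      then show ?thesis using Dsym[of m i] by simp
    qed
  qed
  finally have S: "?S = (\<Sum>i\<in>?A. \<Sum>m\<in>?A. ?D i m) / 2" by simp
  have "(\<Sum>i\<in>?A. x i * dunkl n k i q x)
      = (\<Sum>i\<in>?A. x i * pd i q x) + k * (\<Sum>i\<in>?A. \<Sum>m\<in>?A - {i}. ?g i m)"
    unfolding dunkl_def distrib_left sum.distrib sum_distrib_left
    by (simp only: mult_ac)
  also have "(\<Sum>i\<in>?A. \<Sum>m\<in>?A - {i}. ?g i m) = ?S"
    by (intro sum.cong refl full) (simp add: D0)
  also have "?S = (\<Sum>i\<in>?A. \<Sum>m\<in>?A - {i}. ?D i m) / 2"
    unfolding S by (intro arg_cong[where f = "\<lambda>z. z / 2"] sum.cong refl full[symmetric]) (simp add: D0)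
  finally show ?thesis using Euler_hom_poly_fun[OF assms(1)] by simp
qed

text \<open>A maximum principle: \<open>|u|\<close> cannot have a nonzero maximum on the finite orbit
  of \<open>x\<close> under the symmetric group.\<close>

lemma swp_average_unique:
  fixes u :: "(nat \<Rightarrow> real) \<Rightarrow> real"
  assumes "finite A" "r > 0" "k > 0" "inj_on x A"
    and eq: "\<And>y. inj_on y A \<Longrightarrow>
      r * u y + k / 2 * (\<Sum>i\<in>A. \<Sum>m\<in>A - {i}. u y - u (swp m i y)) = 0"
  shows "u x = 0"
proof -
  define X where "X = (\<lambda>\<pi>. x \<circ> \<pi>) ` {\<pi>. \<pi> permutes A}"
  have fin: "finite X" unfolding X_def using assms(1) by (intro finite_imageI finite_permutations)
  have xX: "x \<in> X" unfolding X_def by (rule image_eqI[of _ _ id]) (auto intro: permutes_id)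
  \<comment> \<open>The equation is available only at points with distinct coordinates, a property
    that the whole orbit inherits from \<open>x\<close>.\<close>
  have inj: "inj_on y A" if y: "y \<in> X" for y
  proof -
    obtain \<pi> where "\<pi> permutes A" "y = x \<circ> \<pi>" using y unfolding X_def by auto
    then show ?thesis using assms(4)
      by (auto intro!: comp_inj_on simp: permutes_inj_on permutes_image)
  qed
  have swpX: "swp m i y \<in> X" if y: "y \<in> X" and "i \<in> A" "m \<in> A" for y i m
  proof -
    obtain \<pi> where "\<pi> permutes A" "y = x \<circ> \<pi>" using y unfolding X_def by auto
    then have "swp m i y = x \<circ> (\<pi> \<circ> Transposition.transpose m i)"
      "\<pi> \<circ> Transposition.transpose m i permutes A"
      using that by (auto simp: swp_eq_comp intro!: permutes_compose permutes_swap_id)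
    then show ?thesis unfolding X_def by blast
  qed
  have "Max ((\<lambda>z. \<bar>u z\<bar>) ` X) \<in> (\<lambda>z. \<bar>u z\<bar>) ` X" using fin xX by (intro Max_in) auto
  then obtain y where y: "y \<in> X" and "\<bar>u y\<bar> = Max ((\<lambda>z. \<bar>u z\<bar>) ` X)" by auto
  then have max: "\<bar>u z\<bar> \<le> \<bar>u y\<bar>" if "z \<in> X" for z using fin that by simp
  \<comment> \<open>Multiplying by the sign treats a positive maximum and a negative minimum at
    once.\<close>
  have "0 = sgn (u y) * (r * u y + k / 2 * (\<Sum>i\<in>A. \<Sum>m\<in>A - {i}. u y - u (swp m i y)))"
    using eq[OF inj[OF y]] by simp
  also have "\<dots> = r * \<bar>u y\<bar> + k / 2 * (\<Sum>i\<in>A. \<Sum>m\<in>A - {i}. \<bar>u y\<bar> - sgn (u y) * u (swp m i y))"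
    by (simp add: distrib_left right_diff_distrib sum_distrib_left abs_sgn mult_ac)
  finally have "r * \<bar>u y\<bar> + k / 2 * (\<Sum>i\<in>A. \<Sum>m\<in>A - {i}. \<bar>u y\<bar> - sgn (u y) * u (swp m i y)) = 0"
    by simp
  \<comment> \<open>Every term is nonnegative by maximality of \<open>\<bar>u y\<bar>\<close>, so
    both parts of a vanishing sum vanish, in particular \<open>r * \<bar>u y\<bar>\<close>.\<close>
  moreover have "(\<Sum>i\<in>A. \<Sum>m\<in>A - {i}. \<bar>u y\<bar> - sgn (u y) * u (swp m i y)) \<ge> 0"
  proof (intro sum_nonneg)
    fix i m assume "i \<in> A" "m \<in> A - {i}"
    then have "\<bar>u (swp m i y)\<bar> \<le> \<bar>u y\<bar>" using y by (intro max swpX) auto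
    then show "0 \<le> \<bar>u y\<bar> - sgn (u y) * u (swp m i y)" by (auto simp: sgn_if)
  qed
  ultimately have "r * \<bar>u y\<bar> \<le> 0" using assms(3)
    by (smt (verit) mult_nonneg_nonneg divide_nonneg_pos)
  then have "u y = 0" using assms(2) by (simp add: mult_le_0_iff)
  then show ?thesis using max[OF xX] by simp
qed

lemma hom_poly_fun_imp_poly_fun: "hom_poly_fun n d p \<Longrightarrow> poly_fun n p"
  unfolding hom_poly_fun_def poly_fun_def by blast

lemma hom_poly_fun_coord_power:
  assumes "j \<in> {1..n+1}"
  shows "hom_poly_fun n d (\<lambda>x. x j ^ d)"
proof -
  let ?a = "\<lambda>p. if p = j then d else 0"
  have "monomial n ?a x = (\<Prod>p\<in>{1..n+1}. if p = j then x p ^ d else 1)" for x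
    unfolding monomial_def by (intro prod.cong) auto
  then have "monomial n ?a x = x j ^ d" for x
    using assms by (simp del: prod.cl_ivl_Suc)
  moreover have "(\<Sum>i\<in>{1..n+1}. ?a i) = d" using assms by (simp del: sum.cl_ivl_Suc)
  ultimately show ?thesis
    unfolding hom_poly_fun_def by (intro exI[of _ "{?a}"] exI[of _ "\<lambda>_. 1"]) auto
qed

lemma pd_coord_power:
  "pd i (\<lambda>x. x j ^ d) = (\<lambda>x. (if i = j then real d else 0) * x j ^ (d - 1))"
proof
  fix x :: "nat \<Rightarrow> real"
  have "((\<lambda>s. (x(i := x i + s)) j ^ d) has_real_derivative
      (if i = j then real d else 0) * x j ^ (d - 1)) (at 0)"
    by (cases "i = j") (auto intro!: derivative_eq_intros)
  then show "pd i (\<lambda>x. x j ^ d) x = (if i = j then real d else 0) * x j ^ (d - 1)"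
    unfolding pd_def by (rule DERIV_imp_deriv)
qed

lemma continuous_hom_poly_fun_line:
  assumes "hom_poly_fun n d q"
  shows "isCont (\<lambda>\<epsilon>. q (\<lambda>i. x i + \<epsilon> * y i)) 0"
proof -
  obtain S c where "q = (\<lambda>x. \<Sum>a\<in>S. c a * monomial n a x)"
    using assms unfolding hom_poly_fun_def by blast
  then show ?thesis by (auto simp: monomial_def intro!: continuous_intros)
qed

lemma continuous_dirichlet_moment_line:
  "isCont (\<lambda>\<epsilon>. dirichlet_moment A k d a (\<lambda>i. x i + \<epsilon> * y i)) 0"
  by (induction d arbitrary: a) (auto intro!: continuous_intros)

text \<open>Two distinct coordinates of the moving point agree for one value of
  \<open>\<epsilon>\<close> only, so finitely many values are excluded. The quotients with
  \<open>i = m\<close> evaluate to 0, which a punctured neighbourhood of 0 avoids anyway.\<close>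

lemma eventually_inj_on_line:
  fixes x :: "nat \<Rightarrow> real"
  assumes "finite A"
  shows "eventually (\<lambda>\<epsilon>. inj_on (\<lambda>i. x i + \<epsilon> * real i) A) (at 0)"
proof -
  have "eventually (\<lambda>\<epsilon>. \<forall>i\<in>A. \<forall>m\<in>A. \<epsilon> \<noteq> (x m - x i) / (real i - real m)) (at (0::real))"
    using assms by (intro eventually_ball_finite ballI eventually_neq_at_within)
  then show ?thesis
  proof eventually_elim
    case (elim \<epsilon>)
    show ?case
    proof (rule inj_onI, rule ccontr)
      fix i m assume im: "i \<in> A" "m \<in> A" "x i + \<epsilon> * real i = x m + \<epsilon> * real m" "i \<noteq> m"
      then have "\<epsilon> = (x m - x i) / (real i - real m)" by (simp add: field_simps)
      then show False using elim im by blast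
    qed
  qed
qed

text \<open>This fixes the constant: it starts the induction on the degree and later gives the
  Dirichlet law total mass 1. The factor \<open>n + 1\<close> in \<open>c_const\<close> compensates
  for the weight \<open>t_j\<close>, whose mean under \<open>w\<close> is
  \<open>1 / (n + 1)\<close>.\<close>

lemma c_const_dirichlet_coord_moment_0:
  assumes "k > 0" "j \<in> {1..n+1}"
  shows "c_const n k * dirichlet_coord_moment {1..n+1} k 0 j x = 1"
proof -
  let ?N = "(real n + 1) * k"
  have v: "dirichlet_value {1..n+1} k (\<lambda>_. 0) = Gamma k ^ (n + 1) / Gamma ?N"
    by (simp add: dirichlet_value_def del: prod.cl_ivl_Suc sum.cl_ivl_Suc) (simp add: algebra_simps)
  have N: "?N > 0" using assms by simp
  have G: "Gamma k > 0" "Gamma ?N > 0" using assms N by (auto simp del: mult_pos_pos)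
  have "?N * dirichlet_value {1..n+1} k (incr j (\<lambda>_. 0)) = k * (Gamma k ^ (n + 1) / Gamma ?N)"
    using dirichlet_value_incr[OF _ assms, of "\<lambda>_. 0"] v by (simp add: algebra_simps)
  then have "(real n + 1) * dirichlet_value {1..n+1} k (incr j (\<lambda>_. 0)) = Gamma k ^ (n + 1) / Gamma ?N"
    using assms(1) by (simp only: mult.assoc mult.left_commute[of "real n + 1" k] mult_cancel_left) auto
  then show ?thesis using G unfolding c_const_def dirichlet_moment.simps
    by (simp add: field_simps)
qed

theorem intertwiner_coord_power:
  assumes "k > 0" "j \<in> {1..n+1}" "is_intertwiner n k V"
  shows "V (\<lambda>x. x j ^ d) x = c_const n k * dirichlet_coord_moment {1..n+1} k d j x"
proof (induction d arbitrary: x)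
  case 0
  then show ?case
    using assms(3) c_const_dirichlet_coord_moment_0[OF assms(1,2)]
    by (simp add: is_intertwiner_def del: dirichlet_moment.simps)
next
  case (Suc d)
  let ?A = "{1..n+1}"
  let ?p = "\<lambda>d x. x j ^ d :: real"
  define F where "F d x = c_const n k * dirichlet_coord_moment ?A k d j x" for d x
  define u where "u x = V (?p (Suc d)) x - F (Suc d) x" for x
  have poly: "poly_fun n (?p d)" "hom_poly_fun n d (?p d)" for d
    using hom_poly_fun_coord_power[OF assms(2)] hom_poly_fun_imp_poly_fun by blast+
  have Vhom: "hom_poly_fun n d (V (?p d))" for d
    using assms(3) poly unfolding is_intertwiner_def by blast
  \<comment> \<open>By the intertwining relation only the \<open>j\<close>-th Dunkl operator
    contributes, and it leads back to degree \<open>d\<close>.\<close>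
  have dunkl: "dunkl n k i (V (?p (Suc d))) y = (if i = j then real (Suc d) else 0) * V (?p d) y"
    if "i \<in> ?A" "inj_on y ?A" for i y
  proof -
    have "dunkl n k i (V (?p (Suc d))) y = V (pd i (?p (Suc d))) y"
      using assms(3) poly that unfolding is_intertwiner_def by blast
    also have "pd i (?p (Suc d)) = (\<lambda>x. (if i = j then real (Suc d) else 0) * ?p d x)"
      unfolding pd_coord_power by simp
    also have "V \<dots> = (\<lambda>x. (if i = j then real (Suc d) else 0) * V (?p d) x)"
      using assms(3) poly unfolding is_intertwiner_def by blast
    finally show ?thesis .
  qed
  \<comment> \<open>Both sides of the claim solve the same inhomogeneous equation, so their
    difference solves the homogeneous one and the maximum principle applies.\<close>
  have u0: "u y = 0" if "inj_on y ?A" for y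
  proof (rule swp_average_unique[where u = u and r = "real (Suc d)" and k = k and A = ?A])
    fix y :: "nat \<Rightarrow> real" assume y: "inj_on y ?A"
    let ?v = "V (?p (Suc d))"
    have "real (Suc d) * ?v y + k / 2 * (\<Sum>i\<in>?A. \<Sum>m\<in>?A - {i}. ?v y - ?v (swp m i y))
        = (\<Sum>i\<in>?A. y i * ((if i = j then real (Suc d) else 0) * V (?p d) y))"
      unfolding Euler_dunkl[OF Vhom y, symmetric] by (intro sum.cong refl) (simp only: dunkl y)
    also have "\<dots> = (\<Sum>i\<in>?A. if i = j then real (Suc d) * (y j * F d y) else 0)"
      using Suc.IH by (intro sum.cong refl) (simp add: F_def)
    also have "\<dots> = real (Suc d) * (y j * F d y)"
      using assms(2) by (simp del: sum.cl_ivl_Suc of_nat_Suc)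
    also have "\<dots> = real (Suc d) * F (Suc d) y
        + k / 2 * (\<Sum>i\<in>?A. \<Sum>m\<in>?A - {i}. F (Suc d) y - F (Suc d) (swp m i y))"
      using arg_cong[OF dirichlet_coord_moment_Euler[OF finite_atLeastAtMost assms(1,2), of "Suc d" y],
          of "\<lambda>z. c_const n k * z"]
      unfolding F_def right_diff_distrib[symmetric] sum_distrib_left[symmetric] diff_Suc_1
      by (simp add: distrib_left mult_ac del: dirichlet_moment.simps sum.cl_ivl_Suc of_nat_Suc)
    finally have "real (Suc d) * u y + k / 2 *
        ((\<Sum>i\<in>?A. \<Sum>m\<in>?A - {i}. ?v y - ?v (swp m i y))
          - (\<Sum>i\<in>?A. \<Sum>m\<in>?A - {i}. F (Suc d) y - F (Suc d) (swp m i y))) = 0"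
      unfolding u_def right_diff_distrib by linarith
    also have "(\<Sum>i\<in>?A. \<Sum>m\<in>?A - {i}. ?v y - ?v (swp m i y))
          - (\<Sum>i\<in>?A. \<Sum>m\<in>?A - {i}. F (Suc d) y - F (Suc d) (swp m i y))
        = (\<Sum>i\<in>?A. \<Sum>m\<in>?A - {i}. u y - u (swp m i y))"
      unfolding sum_subtractf[symmetric] u_def by (intro sum.cong refl) simp
    finally show "real (Suc d) * u y + k / 2 * (\<Sum>i\<in>?A. \<Sum>m\<in>?A - {i}. u y - u (swp m i y)) = 0" .
  qed (use assms that in auto)
  \<comment> \<open>Points with coinciding coordinates are reached by continuity along a line on
    which nearby points have distinct coordinates.\<close>
  let ?l = "\<lambda>\<epsilon> i. x i + \<epsilon> * real i"
  have "isCont (\<lambda>\<epsilon>. u (?l \<epsilon>)) 0"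
    unfolding u_def F_def
    by (intro continuous_intros continuous_hom_poly_fun_line[OF Vhom] continuous_dirichlet_moment_line)
  then have "((\<lambda>\<epsilon>. u (?l \<epsilon>)) \<longlongrightarrow> u (?l 0)) (at 0)" unfolding isCont_def .
  moreover have "((\<lambda>\<epsilon>. u (?l \<epsilon>)) \<longlongrightarrow> 0) (at 0)"
    using eventually_inj_on_line[of ?A x] u0
    by (intro tendsto_eventually) (auto elim!: eventually_mono simp del: One_nat_def)
  ultimately have "u (?l 0) = 0" by (intro tendsto_unique[of "at (0::real)"]) auto
  then show ?case by (simp add: u_def F_def del: dirichlet_moment.simps)
qed

section \<open>Integral form of the moments\<close>

lemma sum_tfull: "(\<Sum>p\<in>{1..n+1}. tfull n t p) = 1"
  by (simp add: tfull_def)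

lemma simplex_par_iff:
  "t \<in> simplex_par n \<longleftrightarrow> (\<forall>p\<in>{1..n}. 0 \<le> t p) \<and> sum t {1..n} \<le> 1"
proof -
  have A: "{1..n+1} = insert (n + 1) {1..n}" by auto
  show ?thesis unfolding simplex_par_def mem_Collect_eq A ball_simps by (auto simp: tfull_def)
qed

lemma measurable_tfull [measurable]:
  assumes "p \<in> {1..n+1}"
  shows "(\<lambda>t. tfull n t p) \<in> borel_measurable (PiM {1..n} (\<lambda>_. lborel))"
proof (cases "p = n + 1")
  case True
  then show ?thesis by (simp add: tfull_def)
next
  case False
  then have "p \<in> {1..n}" using assms by auto
  then show ?thesis using False by (simp add: tfull_def)
qed

lemma measurable_indicator_simplex_par [measurable]:
  "(indicator (simplex_par n) :: _ \<Rightarrow> real) \<in> borel_measurable (PiM {1..n} (\<lambda>_. lborel))"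
proof -
  have [measurable]: "Measurable.pred (PiM {1..n} (\<lambda>_. lborel)) (\<lambda>t. \<forall>p\<in>{1..n+1}. 0 \<le> tfull n t p)"
    by measurable
  have "indicator (simplex_par n) = (\<lambda>t. if \<forall>p\<in>{1..n+1}. 0 \<le> tfull n t p then 1 else (0::real))"
    by (auto simp: simplex_par_def indicator_def)
  then show ?thesis by (simp only:) measurable
qed

text \<open>Absorbing each power \<open>t_p ^ a p\<close> into the weight gives exponents
  \<open>k + a p - 1\<close>, so the integral is the Dirichlet integral already computed, with the
  last coordinate in the role of \<open>b\<close>.\<close>

lemma has_integral_Dirichlet_monomial:
  assumes "k > 0"
  shows "has_bochner_integral (PiM {1..n} (\<lambda>_. lborel)) (\<lambda>t. indicator (simplex_par n) t *
      ((\<Prod>p\<in>{1..n+1}. tfull n t p ^ a p) * (\<Prod>p\<in>{1..n+1}. tfull n t p) powr (k - 1)))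
    (dirichlet_value {1..n+1} k a)" (is "has_bochner_integral ?M ?f _")
proof (rule has_bochner_integral_nn_integral)
  let ?b = "\<lambda>p. k + real (a p)"
  have b: "?b p > 0" for p using assms by (simp add: add_pos_nonneg)
  have A: "{1..n+1} = insert (n + 1) {1..n}" by auto
  have f: "?f t = indicator {t. (\<forall>p\<in>{1..n}. 0 \<le> t p) \<and> sum t {1..n} \<le> 1} t *
       ((\<Prod>p\<in>{1..n}. t p powr (?b p - 1)) * (1 - sum t {1..n}) powr (?b (n + 1) - 1))" for t
  proof (cases "t \<in> simplex_par n")
    case True
    \<comment> \<open>At \<open>y = 0\<close> both sides are 0 whatever the exponents, since
      \<open>0 powr z = 0\<close> even for \<open>z = 0\<close>.\<close>
    have pw: "y ^ m * y powr (k - 1) = y powr (k + real m - 1)" if "y \<ge> 0" for y :: real and m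
    proof (cases "y = 0")
      case False
      then show ?thesis using that
        by (simp add: powr_realpow[symmetric] powr_add[symmetric] algebra_simps)
    qed simp
    have "(\<Prod>p\<in>{1..n+1}. tfull n t p ^ a p) * (\<Prod>p\<in>{1..n+1}. tfull n t p) powr (k - 1)
        = (\<Prod>p\<in>{1..n+1}. tfull n t p powr (?b p - 1))"
      unfolding prod_powr_distrib prod.distrib[symmetric]
      using True by (intro prod.cong refl pw) (auto simp: simplex_par_def)
    also have "\<dots> = (1 - sum t {1..n}) powr (?b (n + 1) - 1) * (\<Prod>p\<in>{1..n}. t p powr (?b p - 1))"
      unfolding A by (subst prod.insert) (auto simp: tfull_def intro!: prod.cong)
    finally show ?thesis using True simplex_par_iff[of t n] by simp
  next
    case False
    then show ?thesis using simplex_par_iff[of t n] by simp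
  qed
  show "(\<integral>\<^sup>+t. ennreal (?f t) \<partial>?M) = ennreal (dirichlet_value {1..n+1} k a)"
    unfolding f using b
    by (subst nn_integral_Dirichlet) (simp_all add: dirichlet_value_def)
  show "0 \<le> dirichlet_value {1..n+1} k a"
    unfolding dirichlet_value_def using b
    by (intro divide_nonneg_nonneg prod_nonneg Gamma_real_nonneg sum_pos) auto
  show "AE t in ?M. 0 \<le> ?f t"
    by (intro AE_I2) (simp only: f, intro mult_nonneg_nonneg prod_nonneg, auto)
qed measurable

text \<open>Each recursion step of \<open>dirichlet_moment\<close> expands one factor of the power
  of the linear form, so linearity of the integral carries the induction.\<close>

lemma has_integral_Dirichlet_moment:
  assumes "k > 0"
  shows "has_bochner_integral (PiM {1..n} (\<lambda>_. lborel)) (\<lambda>t. indicator (simplex_par n) t *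
      ((\<Sum>p\<in>{1..n+1}. x p * tfull n t p) ^ d * (\<Prod>p\<in>{1..n+1}. tfull n t p ^ a p) *
        (\<Prod>p\<in>{1..n+1}. tfull n t p) powr (k - 1)))
    (dirichlet_moment {1..n+1} k d a x)"
proof (induction d arbitrary: a)
  case 0
  show ?case using has_integral_Dirichlet_monomial[OF assms, of n a]
    by (simp only: power_0 mult_1 dirichlet_moment.simps)
next
  case (Suc d)
  let ?A = "{1..n+1}"
  let ?w = "\<lambda>t. (\<Prod>p\<in>?A. tfull n t p) powr (k - 1)"
  let ?l = "\<lambda>t. \<Sum>p\<in>?A. x p * tfull n t p"
  have mon: "(\<Prod>q\<in>?A. tfull n t q ^ incr p a q) = tfull n t p * (\<Prod>q\<in>?A. tfull n t q ^ a q)"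
    if "p \<in> ?A" for t p
  proof -
    have "(\<Prod>q\<in>?A. tfull n t q ^ incr p a q)
        = (\<Prod>q\<in>?A. (if q = p then tfull n t q else 1) * tfull n t q ^ a q)"
      by (intro prod.cong) (auto simp: incr_apply)
    then show ?thesis using that by (simp add: prod.distrib del: prod.cl_ivl_Suc)
  qed
  have eq: "indicator (simplex_par n) t * (?l t ^ Suc d * (\<Prod>q\<in>?A. tfull n t q ^ a q) * ?w t)
     = (\<Sum>p\<in>?A. x p * (indicator (simplex_par n) t *
          (?l t ^ d * (\<Prod>q\<in>?A. tfull n t q ^ incr p a q) * ?w t)))" for t
  proof -
    have "(\<Sum>p\<in>?A. x p * (indicator (simplex_par n) t *
          (?l t ^ d * (\<Prod>q\<in>?A. tfull n t q ^ incr p a q) * ?w t)))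
       = (\<Sum>p\<in>?A. (x p * tfull n t p) * (indicator (simplex_par n) t *
          (?l t ^ d * (\<Prod>q\<in>?A. tfull n t q ^ a q) * ?w t)))"
      by (intro sum.cong refl) (simp only: mon mult_ac)
    then show ?thesis unfolding sum_distrib_right[symmetric] by (simp only: power_Suc mult_ac)
  qed
  show ?case unfolding eq dirichlet_moment.simps
    by (intro has_bochner_integral_sum has_bochner_integral_mult_right Suc.IH)
qed

lemma has_integral_Dirichlet_coord_moment:
  assumes "k > 0" "j \<in> {1..n+1}"
  shows "has_bochner_integral (PiM {1..n} (\<lambda>_. lborel)) (\<lambda>t. indicator (simplex_par n) t *
      ((\<Sum>p\<in>{1..n+1}. x p * tfull n t p) ^ d * tfull n t j *
        (\<Prod>p\<in>{1..n+1}. tfull n t p) powr (k - 1)))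
    (dirichlet_coord_moment {1..n+1} k d j x)"
proof -
  have "(\<Prod>p\<in>{1..n+1}. tfull n t p ^ incr j (\<lambda>_. 0) p)
      = (\<Prod>p\<in>{1..n+1}. if p = j then tfull n t p else 1)" for t
    by (intro prod.cong) (auto simp: incr_apply)
  then have "(\<Prod>p\<in>{1..n+1}. tfull n t p ^ incr j (\<lambda>_. 0) p) = tfull n t j" for t
    using assms(2) by (simp del: prod.cl_ivl_Suc)
  then show ?thesis
    using has_integral_Dirichlet_moment[OF assms(1), of n x d "incr j (\<lambda>_. 0)"] by (simp only:)
qed

text \<open>Two bounded random variables, possibly on different spaces, have the same law if their
  moments agree. Polynomials have equal expectations, and on the common interval
  \<open>{-B..B}\<close> they approximate \<open>f\<close> uniformly.\<close>

lemma integral_continuous_eq_of_moments: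
  fixes Y :: "'a \<Rightarrow> real" and Z :: "'b \<Rightarrow> real" and f :: "real \<Rightarrow> real"
  assumes P: "prob_space P" and Q: "prob_space Q"
    and Y [measurable]: "Y \<in> borel_measurable P" and Z [measurable]: "Z \<in> borel_measurable Q"
    and YB: "AE y in P. \<bar>Y y\<bar> \<le> B" and ZB: "AE z in Q. \<bar>Z z\<bar> \<le> B"
    and mom: "\<And>d. (\<integral>y. Y y ^ d \<partial>P) = (\<integral>z. Z z ^ d \<partial>Q)"
    and f: "continuous_on UNIV f"
  shows "(\<integral>y. f (Y y) \<partial>P) = (\<integral>z. f (Z z) \<partial>Q)"
proof -
  interpret P: prob_space P by fact
  interpret Q: prob_space Q by fact
  have bdd: "\<exists>C. \<forall>y. \<bar>y\<bar> \<le> B \<longrightarrow> \<bar>g y\<bar> \<le> C" if "continuous_on UNIV g" for g :: "real \<Rightarrow> real"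
  proof -
    have "bounded (g ` {-B..B})"
      using that by (intro compact_imp_bounded compact_continuous_image) (auto intro: continuous_on_subset)
    then obtain C where "\<forall>y\<in>g ` {-B..B}. \<bar>y\<bar> \<le> C" by (auto simp: bounded_iff)
    then show ?thesis by (intro exI[of _ C]) (auto simp: abs_le_iff)
  qed
  have intP: "integrable P (\<lambda>y. g (Y y))" if g: "continuous_on UNIV g" for g :: "real \<Rightarrow> real"
  proof -
    obtain C where "\<forall>y. \<bar>y\<bar> \<le> B \<longrightarrow> \<bar>g y\<bar> \<le> C" using bdd[OF g] by blast
    moreover have [measurable]: "g \<in> borel_measurable borel"
      using g by (rule borel_measurable_continuous_onI)
    ultimately show ?thesis using YB by (intro P.integrable_const_bound[where B = C]) auto
  qed
  have intQ: "integrable Q (\<lambda>y. g (Z y))" if g: "continuous_on UNIV g" for g :: "real \<Rightarrow> real"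
  proof -
    obtain C where "\<forall>y. \<bar>y\<bar> \<le> B \<longrightarrow> \<bar>g y\<bar> \<le> C" using bdd[OF g] by blast
    moreover have [measurable]: "g \<in> borel_measurable borel"
      using g by (rule borel_measurable_continuous_onI)
    ultimately show ?thesis using ZB by (intro Q.integrable_const_bound[where B = C]) auto
  qed
  have "\<bar>(\<integral>y. f (Y y) \<partial>P) - (\<integral>z. f (Z z) \<partial>Q)\<bar> \<le> 0 + e" if e: "e > 0" for e
  proof -
    \<comment> \<open>An error of \<open>e / 2\<close> is allowed for each of the two
      integrals.\<close>
    obtain g where "real_polynomial_function g" and g: "\<And>x. x \<in> {-B..B} \<Longrightarrow> \<bar>f x - g x\<bar> < e / 2"
      by (rule Stone_Weierstrass_real_polynomial_function[of "{-B..B}" f "e / 2"])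
         (use f e in \<open>auto intro: continuous_on_subset\<close>)
    then obtain a N where gs: "g = (\<lambda>x. \<Sum>i\<le>N. a i * x ^ i)"
      by (auto simp: real_polynomial_function_iff_sum)
    have cg: "continuous_on UNIV g" unfolding gs by (intro continuous_intros)
    have pw: "continuous_on UNIV (\<lambda>x::real. x ^ i)" for i by (intro continuous_intros)
    have gPQ: "(\<integral>y. g (Y y) \<partial>P) = (\<integral>z. g (Z z) \<partial>Q)"
      unfolding gs using intP[OF pw] intQ[OF pw] mom by (simp add: integral_sum)
    have "\<bar>\<integral>y. f (Y y) - g (Y y) \<partial>P\<bar> \<le> (\<integral>y. \<bar>f (Y y) - g (Y y)\<bar> \<partial>P)"
      by (rule integral_abs_bound)
    also have "\<dots> \<le> e / 2"
    proof (rule P.integral_le_const)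
      show "AE y in P. \<bar>f (Y y) - g (Y y)\<bar> \<le> e / 2"
        using YB by eventually_elim (rule less_imp_le, rule g, simp add: abs_le_iff)
    qed (intro integrable_abs Bochner_Integration.integrable_diff intP f cg)
    finally have "\<bar>(\<integral>y. f (Y y) \<partial>P) - (\<integral>y. g (Y y) \<partial>P)\<bar> \<le> e / 2"
      using intP[OF f] intP[OF cg] by simp
    moreover have "\<bar>\<integral>y. f (Z y) - g (Z y) \<partial>Q\<bar> \<le> (\<integral>y. \<bar>f (Z y) - g (Z y)\<bar> \<partial>Q)"
      by (rule integral_abs_bound)
    moreover have "\<dots> \<le> e / 2"
    proof (rule Q.integral_le_const)
      show "AE y in Q. \<bar>f (Z y) - g (Z y)\<bar> \<le> e / 2"
        using ZB by eventually_elim (rule less_imp_le, rule g, simp add: abs_le_iff)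
    qed (intro integrable_abs Bochner_Integration.integrable_diff intQ f cg)
    ultimately show ?thesis
      using gPQ unfolding Bochner_Integration.integral_diff[OF intQ[OF f] intQ[OF cg]] by linarith
  qed
  then have "\<bar>(\<integral>y. f (Y y) \<partial>P) - (\<integral>z. f (Z z) \<partial>Q)\<bar> \<le> 0" by (rule field_le_epsilon)
  then show ?thesis by simp
qed

section \<open>From moments to smooth functions\<close>

text \<open>On smooth functions the operator is defined by its representing measure, so the left
  side, an integral against \<open>\<mu> lam\<close>, is the value of \<open>V_k(F)\<close> at
  \<open>lam\<close>.\<close>

theorem theorem4p6:
  fixes n j :: nat and k :: real and f :: "real \<Rightarrow> real"
    and V :: "((nat \<Rightarrow> real) \<Rightarrow> real) \<Rightarrow> ((nat \<Rightarrow> real) \<Rightarrow> real)"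
    and \<mu> :: "(nat \<Rightarrow> real) \<Rightarrow> (nat \<Rightarrow> real) measure"
    and lam :: "nat \<Rightarrow> real"
  assumes "n \<ge> 1" and "k > 0" and "j \<in> {1..n+1}"
    and "smooth_fun f"
    and "is_intertwiner n k V" and "represents n V \<mu>"
  shows "integral\<^sup>L (\<mu> lam) (\<lambda>y. f (y j)) =
    c_const n k * integral\<^sup>L (PiM {1..n} (\<lambda>_. lborel))
      (\<lambda>t. indicator (simplex_par n) t *
           (f (\<Sum>p\<in>{1..n+1}. lam p * tfull n t p) * tfull n t j *
            (\<Prod>p\<in>{1..n+1}. tfull n t p) powr (k - 1)))"
proof -
  let ?A = "{1..n+1}" and ?M = "PiM {1..n} (\<lambda>_. lborel :: real measure)" and ?c = "c_const n k"
  define Z where "Z t = (\<Sum>p\<in>?A. lam p * tfull n t p)" for t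
  \<comment> \<open>The density \<open>c t_j w\<close> on the simplex. Under the resulting law
    \<open>Q\<close>, the right side of the theorem is the expectation of
    \<open>f (Z t)\<close>.\<close>
  define g where "g t = ?c * (indicator (simplex_par n) t *
     (tfull n t j * (\<Prod>p\<in>?A. tfull n t p) powr (k - 1)))" for t
  define Q where "Q = density ?M (\<lambda>t. ennreal (g t))"
  note [measurable] = measurable_tfull[OF assms(3)]
  have Zm [measurable]: "Z \<in> borel_measurable ?M" unfolding Z_def by measurable
  have gm [measurable]: "g \<in> borel_measurable ?M" unfolding g_def by measurable
  have c: "?c \<ge> 0" unfolding c_const_def using assms(2) by simp
  have g0: "g t \<ge> 0" for t
    unfolding g_def using c assms(3) by (auto simp: indicator_def simplex_par_def)
  have gQ: "(\<integral>t. h (Z t) \<partial>Q) = ?c * (\<integral>t. indicator (simplex_par n) t *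
      (h (Z t) * tfull n t j * (\<Prod>p\<in>?A. tfull n t p) powr (k - 1)) \<partial>?M)"
    if [measurable]: "h \<in> borel_measurable borel" for h :: "real \<Rightarrow> real"
  proof -
    have "(\<integral>t. h (Z t) \<partial>Q) = (\<integral>t. g t * h (Z t) \<partial>?M)"
      unfolding Q_def using g0 by (subst integral_density) (auto simp del: One_nat_def)
    also have "\<dots> = (\<integral>t. ?c * (indicator (simplex_par n) t *
      (h (Z t) * tfull n t j * (\<Prod>p\<in>?A. tfull n t p) powr (k - 1))) \<partial>?M)"
      unfolding g_def by (simp only: mult_ac)
    finally show ?thesis by simp
  qed
  have momQ: "(\<integral>t. Z t ^ d \<partial>Q) = ?c * dirichlet_coord_moment ?A k d j lam" for d
    using gQ[of "\<lambda>y. y ^ d"]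
      has_bochner_integral_integral_eq[OF has_integral_Dirichlet_coord_moment[OF assms(2,3), of lam d]]
    unfolding Z_def by simp
  \<comment> \<open>The total mass of \<open>Q\<close> is its moment of degree 0.\<close>
  have "has_bochner_integral ?M g 1"
  proof -
    have "has_bochner_integral ?M g (?c * dirichlet_coord_moment ?A k 0 j lam)"
      using has_bochner_integral_mult_right[OF has_integral_Dirichlet_coord_moment[OF assms(2,3), of lam 0], of ?c]
      unfolding g_def by (simp only: power_0 mult_1)
    then show ?thesis unfolding c_const_dirichlet_coord_moment_0[OF assms(2,3)] .
  qed
  then have "(\<integral>\<^sup>+t. ennreal (g t) \<partial>?M) = 1"
    using g0 by (simp add: has_bochner_integral_iff nn_integral_eq_integral)
  then have Q: "prob_space Q"
    unfolding Q_def by (intro prob_spaceI) (simp add: emeasure_density cong: nn_integral_cong del: One_nat_def)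
  have rep: "sets (\<mu> lam) = sets (PiM ?A (\<lambda>_. lborel))" "prob_space (\<mu> lam)"
      "\<And>p. poly_fun n p \<Longrightarrow> V p lam = integral\<^sup>L (\<mu> lam) p"
    using assms(6) unfolding represents_def by blast+
  obtain B where B: "AE y in \<mu> lam. \<forall>i\<in>?A. \<bar>y i\<bar> \<le> B"
    using assms(6) unfolding represents_def by blast
  \<comment> \<open>A bound valid for both variables: \<open>B\<close> controls \<open>y j\<close>,
    and \<open>Z t\<close> is a convex combination of the coordinates of \<open>lam\<close>.\<close>
  define C where "C = max B (\<Sum>p\<in>?A. \<bar>lam p\<bar>)"
  have ZC: "\<bar>Z t\<bar> \<le> C" if "t \<in> simplex_par n" for t
  proof -
    have t0: "tfull n t p \<ge> 0" if "p \<in> ?A" for p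
      using \<open>t \<in> simplex_par n\<close> that by (auto simp: simplex_par_def)
    have t1: "tfull n t p \<le> 1" if "p \<in> ?A" for p
      unfolding sum_tfull[of n t, symmetric] using that t0 by (intro member_le_sum) auto
    have "\<bar>Z t\<bar> \<le> (\<Sum>p\<in>?A. \<bar>lam p * tfull n t p\<bar>)" unfolding Z_def by (rule sum_abs)
    also have "\<dots> \<le> (\<Sum>p\<in>?A. \<bar>lam p\<bar>)"
      using t0 t1 by (intro sum_mono) (simp add: abs_mult mult_left_le)
    finally show ?thesis by (simp add: C_def)
  qed
  have "f differentiable (at x)" for x
    using assms(4) unfolding smooth_fun_def by (metis funpow_0)
  then have f: "continuous_on UNIV f"
    by (intro continuous_at_imp_continuous_on ballI differentiable_imp_continuous_within)
  have "integral\<^sup>L (\<mu> lam) (\<lambda>y. f (y j)) = (\<integral>t. f (Z t) \<partial>Q)"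
  proof (rule integral_continuous_eq_of_moments[OF rep(2) Q _ _ _ _ _ f, where B = C])
    show "(\<lambda>y. y j) \<in> borel_measurable (\<mu> lam)"
      unfolding measurable_cong_sets[OF rep(1) refl]
      using measurable_component_singleton[OF assms(3), of "\<lambda>_. lborel :: real measure"] by simp
    show "Z \<in> borel_measurable Q" unfolding Q_def by measurable
    show "AE y in \<mu> lam. \<bar>y j\<bar> \<le> C"
      using B by eventually_elim (use assms(3) in \<open>auto simp: C_def le_max_iff_disj simp del: One_nat_def\<close>)
    show "AE t in Q. \<bar>Z t\<bar> \<le> C"
    \<comment> \<open>Outside the simplex the density \<open>g\<close> is zero, so the bound is
      needed only on \<open>simplex_par n\<close>.\<close>
    proof -
      have "(\<lambda>t. ennreal (g t)) \<in> borel_measurable ?M" by measurable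
      then show ?thesis
        unfolding Q_def by (subst AE_density) (auto simp: g_def ZC indicator_def split: if_splits)
    qed
    fix d
    have "(\<integral>y. y j ^ d \<partial>\<mu> lam) = V (\<lambda>x. x j ^ d) lam"
      by (rule rep(3)[symmetric])
         (rule hom_poly_fun_imp_poly_fun[OF hom_poly_fun_coord_power[OF assms(3)]])
    then show "(\<integral>y. y j ^ d \<partial>\<mu> lam) = (\<integral>t. Z t ^ d \<partial>Q)"
      unfolding momQ intertwiner_coord_power[OF assms(2,3,5)] .
  qed
  also have "\<dots> = ?c * (\<integral>t. indicator (simplex_par n) t *
      (f (Z t) * tfull n t j * (\<Prod>p\<in>?A. tfull n t p) powr (k - 1)) \<partial>?M)"
    by (rule gQ) (rule borel_measurable_continuous_onI[OF f])
  finally show ?thesis unfolding Z_def .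
qed

end
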